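(* Let $(X,\delta)$ be a pseudodiversity and let $\mathcal{C}$ be the conformity on $X$ generated by $\delta$. Then $(X,\delta)$ is complete if and only if $\mathcal{C}$ is complete.
   Context: For a set $X$, $\mathcal{P}_{\mathrm{fin}}(X)$ denotes the set of all finite subsets of $X$ (including $\varnothing$). A pseudodiversity is a pair $(X,\delta)$ with $\delta:\mathcal{P}_{\mathrm{fin}}(X)\to\mathbb{R}$ such that $\delta(A)\ge 0$ for all $A$, $\delta(A)=0$ whenever $|A|\le 1$, and $\delta(A\cup B)\le\delta(A\cup C)+\delta(C\cup B)$ for all $A,B,C\in\mathcal{P}_{\mathrm{fin}}(X)$ with $C\ne\varnothing$. A sequence $\{x_n\}$ in $X$ converges to $x\in X$ in $(X,\delta)$ if $\lim_{N\to\infty}\sup_{i_1,\ldots,i_n\ge N}\delta(\{x,x_{i_1},\ldots,x_{i_n}\})=0$, and is Cauchy if $\lim_{N\to\infty}\sup_{i_1,\ldots,i_n\ge N}\delta(\{x_{i_1},\ldots,x_{i_n}\})=0$, where the suprema are over all finite tuples (of any length $n$) of indices $\ge N$. $(X,\delta)$ is complete if every Cauchy sequence converges to some point of $X$. Filters are nonempty, closed under finite intersections and supersets, and do not contain $\varnothing$. The conformity $\mathcal{C}$ generated by $\delta$ is the filter on the set $\mathcal{P}_{\mathrm{fin}}(X)$ generated by the sets $\{A\in\mathcal{P}_{\mathrm{fin}}(X):\delta(A)\le\epsilon\}$, $\epsilon>0$. A filter $F$ on $X$ is a Cauchy filter (with respect to $\mathcal{C}$) if for every $C\in\mathcal{C}$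 there is $f\in F$ with $\mathcal{P}_{\mathrm{fin}}(f)\subseteq C$. A filter $F$ on $X$ converges to $x\in X$ (with respect to $\mathcal{C}$) if for every $C\in\mathcal{C}$ there is $f\in F$ with $\mathcal{P}_{\mathrm{fin}}(f)\subseteq\{A: A\cup\{x\}\in C\}$. $\mathcal{C}$ is complete if every Cauchy filter on $X$ converges to some point of $X$. *)

theory Defs
  imports Complex_Main "HOL-Library.Extended_Real"
begin

text \<open>The ground set is a carrier \<open>X\<close>, and its finite subsets form \<^term>\<open>Fpow X\<close>.
  The values of \<open>\<delta>\<close> outside \<^term>\<open>Fpow X\<close> are irrelevant.\<close>

definition pseudodiversity :: "'a set \<Rightarrow> ('a set \<Rightarrow> real) \<Rightarrow> bool" where
  "pseudodiversity X \<delta> \<longleftrightarrow>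
     (\<forall>A\<in>Fpow X. 0 \<le> \<delta> A) \<and>
     (\<forall>A\<in>Fpow X. card A \<le> 1 \<longrightarrow> \<delta> A = 0) \<and>
     (\<forall>A\<in>Fpow X. \<forall>B\<in>Fpow X. \<forall>C\<in>Fpow X. C \<noteq> {} \<longrightarrow> \<delta> (A \<union> B) \<le> \<delta> (A \<union> C) + \<delta> (C \<union> B))"

text \<open>Tuples of indices are nonempty lists. The suprema are taken in the extended reals, since
  they may be infinite.\<close>

definition index_tuples :: "nat \<Rightarrow> nat list set" where
  "index_tuples N = {js \<in> lists {N..}. js \<noteq> []}"

definition seq_converges :: "('a set \<Rightarrow> real) \<Rightarrow> (nat \<Rightarrow> 'a) \<Rightarrow> 'a \<Rightarrow> bool" where
  "seq_converges \<delta> s x \<longleftrightarrow>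
     (\<lambda>N. SUP js\<in>index_tuples N. ereal (\<delta> (insert x (set (map s js))))) \<longlonglongrightarrow> 0"

definition seq_cauchy :: "('a set \<Rightarrow> real) \<Rightarrow> (nat \<Rightarrow> 'a) \<Rightarrow> bool" where
  "seq_cauchy \<delta> s \<longleftrightarrow>
     (\<lambda>N. SUP js\<in>index_tuples N. ereal (\<delta> (set (map s js)))) \<longlonglongrightarrow> 0"

definition diversity_complete :: "'a set \<Rightarrow> ('a set \<Rightarrow> real) \<Rightarrow> bool" where
  "diversity_complete X \<delta> \<longleftrightarrow>
     (\<forall>s. range s \<subseteq> X \<longrightarrow> seq_cauchy \<delta> s \<longrightarrow> (\<exists>x\<in>X. seq_converges \<delta> s x))"

text \<open>The type \<^typ>\<open>'a filter\<close> covers all of \<^typ>\<open>'a\<close> and includes the improper filter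
  \<^term>\<open>bot\<close>. A filter on the set \<open>Y\<close> that does not contain the empty set is therefore a filter
  \<open>F\<close> with \<open>F \<noteq> bot\<close> and \<open>F \<le> principal Y\<close>; the subsets of \<open>Y\<close> belonging to it are
  \<open>filter_sets Y F\<close>.\<close>

definition proper_filter_on :: "'a set \<Rightarrow> 'a filter \<Rightarrow> bool" where
  "proper_filter_on Y F \<longleftrightarrow> F \<noteq> bot \<and> F \<le> principal Y"

definition filter_sets :: "'a set \<Rightarrow> 'a filter \<Rightarrow> 'a set set" where
  "filter_sets Y F = {S. S \<subseteq> Y \<and> eventually (\<lambda>y. y \<in> S) F}"

definition generated_conformity :: "'a set \<Rightarrow> ('a set \<Rightarrow> real) \<Rightarrow> 'a set filter" where
  "generated_conformity X \<delta> = (INF \<epsilon>\<in>{0<..}. principal {A \<in> Fpow X. \<delta> A \<le> \<epsilon>})"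

definition conformity_cauchy :: "'a set \<Rightarrow> 'a set filter \<Rightarrow> 'a filter \<Rightarrow> bool" where
  "conformity_cauchy X \<C> F \<longleftrightarrow>
     (\<forall>C\<in>filter_sets (Fpow X) \<C>. \<exists>f\<in>filter_sets X F. Fpow f \<subseteq> C)"

definition conformity_converges :: "'a set \<Rightarrow> 'a set filter \<Rightarrow> 'a filter \<Rightarrow> 'a \<Rightarrow> bool" where
  "conformity_converges X \<C> F x \<longleftrightarrow>
     (\<forall>C\<in>filter_sets (Fpow X) \<C>. \<exists>f\<in>filter_sets X F. Fpow f \<subseteq> {A. A \<union> {x} \<in> C})"

definition conformity_complete :: "'a set \<Rightarrow> 'a set filter \<Rightarrow> bool" where
  "conformity_complete X \<C> \<longleftrightarrow>
     (\<forall>F. proper_filter_on X F \<longrightarrow> conformity_cauchy X \<C> F \<longrightarrow>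
        (\<exists>x\<in>X. conformity_converges X \<C> F x))"

text \<open>The generated conformity, as a family of subsets of \<^term>\<open>Fpow X\<close>:\<close>

lemma filter_sets_generated_conformity:
  "filter_sets (Fpow X) (generated_conformity X \<delta>) =
     {C. C \<subseteq> Fpow X \<and> (\<exists>\<epsilon>>0. {A \<in> Fpow X. \<delta> A \<le> \<epsilon>} \<subseteq> C)}"
proof -
  have "eventually P (generated_conformity X \<delta>) \<longleftrightarrow>
      (\<exists>\<epsilon>\<in>{0<..}. eventually P (principal {A \<in> Fpow X. \<delta> A \<le> \<epsilon>}))" for P
    unfolding generated_conformity_def
  proof (rule eventually_INF_base)
    fix a b :: real assume "a \<in> {0<..}" "b \<in> {0<..}"
    then show "\<exists>c\<in>{0<..}. principal {A \<in> Fpow X. \<delta> A \<le> c}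
        \<le> inf (principal {A \<in> Fpow X. \<delta> A \<le> a}) (principal {A \<in> Fpow X. \<delta> A \<le> b})"
      by (intro bexI[of _ "min a b"]) auto
  qed (auto intro: exI[of _ 1])
  then show ?thesis
    unfolding filter_sets_def by (auto simp: eventually_principal subset_eq)
qed

lemma proper_filter_on_generated_conformity:
  assumes "pseudodiversity X \<delta>"
  shows "proper_filter_on (Fpow X) (generated_conformity X \<delta>)"
proof -
  have "{} \<in> Fpow X" "\<delta> {} = 0"
    using assms by (auto simp: pseudodiversity_def Fpow_def)
  then have "{} \<notin> filter_sets (Fpow X) (generated_conformity X \<delta>)"
    unfolding filter_sets_generated_conformity by (force simp: subset_eq)
  moreover have "generated_conformity X \<delta> \<le> principal {A \<in> Fpow X. \<delta> A \<le> 1}"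
    unfolding generated_conformity_def by (rule INF_lower) simp
  then have "generated_conformity X \<delta> \<le> principal (Fpow X)"
    by (rule order_trans) auto
  ultimately show ?thesis
    by (auto simp: proper_filter_on_def filter_sets_def)
qed

end

theory Submission
  imports Defs
begin

text \<open>
  All four notions involved, Cauchy or convergent and for sequences or filters, say that a
  function \<open>g\<close> on finite sets is uniformly small on the finite subsets of the tails of a
  sequence, or of the members of a filter. Here \<open>g = \<delta>\<close> for the Cauchy notions and
  \<open>g A = \<delta> (insert x A)\<close> for convergence to \<open>x\<close>. Consequently a sequence is Cauchy, or converges
  to \<open>x\<close>, exactly when its tail filter does (lemmas \<open>seq_cauchy_iff_tail_filter\<close> and
  \<open>seq_converges_iff_tail_filter\<close>), and completeness of the conformity implies completeness of
  the pseudodiversity.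

  For the converse one has to replace an arbitrary Cauchy filter by a sequence. This is possible
  because the generated conformity has a countable base: from members \<open>f n\<close> of the filter
  on whose finite subsets \<open>\<delta>\<close> is at most \<open>1/(n+1)\<close>, pick \<open>s n \<in> f 0 \<inter> \<dots> \<inter> f n\<close>. The sequence
  \<open>s\<close> is Cauchy, and a limit \<open>x\<close> of it is a limit of the filter, since the triangle
  inequality through a single late term \<open>s n\<close> bounds \<open>\<delta> (insert x A)\<close> by
  \<open>\<delta> (insert (s n) A) + \<delta> {s n, x}\<close>, and both summands are small when \<open>A\<close> lies in a late \<open>f N\<close>.
\<close>

section \<open>Pseudodiversities\<close>

lemma pseudodiversity_nonneg:
  assumes "pseudodiversity X \<delta>" "A \<in> Fpow X"
  shows "0 \<le> \<delta> A"
  using assms unfolding pseudodiversity_def by blast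

lemma pseudodiversity_empty:
  assumes "pseudodiversity X \<delta>"
  shows "\<delta> {} = 0"
  using assms unfolding pseudodiversity_def by (simp add: empty_in_Fpow)

lemma pseudodiversity_singleton:
  assumes "pseudodiversity X \<delta>" "x \<in> X"
  shows "\<delta> {x} = 0"
  using assms unfolding pseudodiversity_def by (simp add: Fpow_def)

lemma pseudodiversity_triangle_point:
  assumes "pseudodiversity X \<delta>" "A \<in> Fpow X" "x \<in> X" "c \<in> X"
  shows "\<delta> (insert x A) \<le> \<delta> (insert c A) + \<delta> {c, x}"
proof -
  have "{x} \<in> Fpow X" "{c} \<in> Fpow X"
    using assms by (auto simp: Fpow_def)
  then have "\<delta> (A \<union> {x}) \<le> \<delta> (A \<union> {c}) + \<delta> ({c} \<union> {x})"
    using assms(1,2) unfolding pseudodiversity_def by blast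
  then show ?thesis by (simp add: insert_commute)
qed

section \<open>Sequences\<close>

lemma index_tuples_antimono: "M \<le> N \<Longrightarrow> index_tuples N \<subseteq> index_tuples M"
  by (auto simp: index_tuples_def)

lemma set_map_index_tuples:
  "(\<lambda>js. set (map s js)) ` index_tuples N = Fpow (s ` {N..}) - {{}}"
proof (intro equalityI subsetI)
  fix A assume "A \<in> Fpow (s ` {N..}) - {{}}"
  then obtain J where J: "J \<subseteq> {N..}" "finite J" "A = s ` J" "A \<noteq> {}"
    by (auto simp: Fpow_def dest: finite_subset_image)
  obtain js where "set js = J"
    using J(2) finite_list by blast
  then have "js \<in> index_tuples N" "A = set (map s js)"
    using J by (auto simp: index_tuples_def)
  then show "A \<in> (\<lambda>js. set (map s js)) ` index_tuples N"
    by blast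
qed (auto simp: index_tuples_def Fpow_def)

text \<open>The assumption \<^prop>\<open>g {} = 0\<close> reconciles the nonempty index tuples of the left-hand side
  with the finite subsets of the right-hand side, among which the empty set occurs.\<close>

lemma SUP_index_tuples_tendsto_zero_iff:
  fixes g :: "'a set \<Rightarrow> real"
  assumes nonneg: "\<And>A. A \<in> Fpow (range s) \<Longrightarrow> 0 \<le> g A" and empty: "g {} = 0"
  shows "(\<lambda>N. SUP js\<in>index_tuples N. ereal (g (set (map s js)))) \<longlonglongrightarrow> 0 \<longleftrightarrow>
    (\<forall>\<epsilon>>0. \<exists>N. \<forall>A\<in>Fpow (s ` {N..}). g A \<le> \<epsilon>)"
    (is "?S \<longlonglongrightarrow> 0 \<longleftrightarrow> ?R")
proof -
  have nonneg_SUP: "0 \<le> ?S N" for N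
  proof -
    have "[N] \<in> index_tuples N"
      by (simp add: index_tuples_def)
    moreover have "0 \<le> g (set (map s [N]))"
      by (rule nonneg) (simp add: Fpow_def)
    ultimately show ?thesis
      by (intro SUP_upper2) auto
  qed
  have SUP_le: "?S N \<le> ereal \<epsilon> \<longleftrightarrow> (\<forall>A\<in>Fpow (s ` {N..}). g A \<le> \<epsilon>)" if "0 < \<epsilon>" for N \<epsilon>
  proof -
    have "?S N \<le> ereal \<epsilon> \<longleftrightarrow>
        (\<forall>A\<in>(\<lambda>js. set (map s js)) ` index_tuples N. g A \<le> \<epsilon>)"
      by (simp add: SUP_le_iff)
    also have "\<dots> \<longleftrightarrow> (\<forall>A\<in>Fpow (s ` {N..}). g A \<le> \<epsilon>)"
      unfolding set_map_index_tuples using empty that by auto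
    finally show ?thesis .
  qed
  show ?thesis
  proof
    assume lim: "?S \<longlonglongrightarrow> 0"
    show ?R
    proof (intro allI impI)
      fix \<epsilon> :: real assume \<epsilon>: "0 < \<epsilon>"
      then have "\<forall>\<^sub>F N in sequentially. ?S N < ereal \<epsilon>"
        by (intro order_tendstoD(2)[OF lim]) simp
      then obtain N where "?S N < ereal \<epsilon>"
        using eventually_happens'[OF sequentially_bot] by blast
      then show "\<exists>N. \<forall>A\<in>Fpow (s ` {N..}). g A \<le> \<epsilon>"
        using SUP_le[OF \<epsilon>, of N] less_imp_le by blast
    qed
  next
    assume R: ?R
    show "?S \<longlonglongrightarrow> 0"
    proof (rule order_tendstoI)
      fix a :: ereal assume "a < 0"
      then show "\<forall>\<^sub>F N in sequentially. a < ?S N"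
        using nonneg_SUP by (intro always_eventually allI) (rule less_le_trans)
    next
      fix a :: ereal assume "0 < a"
      then obtain \<epsilon> where \<epsilon>: "0 < \<epsilon>" "ereal \<epsilon> < a"
        using ereal_dense2[of 0 a] by auto
      obtain N where "\<forall>A\<in>Fpow (s ` {N..}). g A \<le> \<epsilon>"
        using R \<epsilon>(1) by blast
      then have N: "?S N \<le> ereal \<epsilon>"
        using SUP_le[OF \<epsilon>(1)] by blast
      have "?S M < a" if "N \<le> M" for M
        using SUP_subset_mono[OF index_tuples_antimono[OF that] order_refl] N \<epsilon>(2)
        by (meson order_trans le_less_trans)
      then show "\<forall>\<^sub>F M in sequentially. ?S M < a"
        by (rule eventually_sequentiallyI)
    qed
  qed
qed

lemma seq_cauchy_iff:
  assumes "pseudodiversity X \<delta>" "range s \<subseteq> X"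
  shows "seq_cauchy \<delta> s \<longleftrightarrow> (\<forall>\<epsilon>>0. \<exists>N. \<forall>A\<in>Fpow (s ` {N..}). \<delta> A \<le> \<epsilon>)"
  unfolding seq_cauchy_def
proof (rule SUP_index_tuples_tendsto_zero_iff)
  show "0 \<le> \<delta> A" if "A \<in> Fpow (range s)" for A
    using that assms(2) Fpow_mono by (intro pseudodiversity_nonneg[OF assms(1)]) blast
qed (rule pseudodiversity_empty[OF assms(1)])

lemma seq_converges_iff:
  assumes "pseudodiversity X \<delta>" "range s \<subseteq> X" "x \<in> X"
  shows "seq_converges \<delta> s x \<longleftrightarrow> (\<forall>\<epsilon>>0. \<exists>N. \<forall>A\<in>Fpow (s ` {N..}). \<delta> (insert x A) \<le> \<epsilon>)"
  unfolding seq_converges_def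
proof (rule SUP_index_tuples_tendsto_zero_iff)
  show "0 \<le> \<delta> (insert x A)" if "A \<in> Fpow (range s)" for A
    using that assms(2,3) by (intro pseudodiversity_nonneg[OF assms(1)]) (auto simp: Fpow_def)
qed (rule pseudodiversity_singleton[OF assms(1,3)])

section \<open>Filters\<close>

lemma conformity_cauchy_iff:
  "conformity_cauchy X (generated_conformity X \<delta>) F \<longleftrightarrow>
    (\<forall>\<epsilon>>0. \<exists>f\<in>filter_sets X F. \<forall>A\<in>Fpow f. \<delta> A \<le> \<epsilon>)"
proof
  assume L: "conformity_cauchy X (generated_conformity X \<delta>) F"
  show "\<forall>\<epsilon>>0. \<exists>f\<in>filter_sets X F. \<forall>A\<in>Fpow f. \<delta> A \<le> \<epsilon>"
  proof (intro allI impI)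
    fix \<epsilon> :: real assume "0 < \<epsilon>"
    then have "{A \<in> Fpow X. \<delta> A \<le> \<epsilon>} \<in> filter_sets (Fpow X) (generated_conformity X \<delta>)"
      unfolding filter_sets_generated_conformity by blast
    then have "\<exists>f\<in>filter_sets X F. Fpow f \<subseteq> {A \<in> Fpow X. \<delta> A \<le> \<epsilon>}"
      using L unfolding conformity_cauchy_def by (rule bspec[rotated])
    then show "\<exists>f\<in>filter_sets X F. \<forall>A\<in>Fpow f. \<delta> A \<le> \<epsilon>"
      by (simp add: subset_eq) blast
  qed
next
  assume R: "\<forall>\<epsilon>>0. \<exists>f\<in>filter_sets X F. \<forall>A\<in>Fpow f. \<delta> A \<le> \<epsilon>"
  show "conformity_cauchy X (generated_conformity X \<delta>) F"
    unfolding conformity_cauchy_def filter_sets_generated_conformity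
  proof (intro ballI, clarify)
    fix C \<epsilon> assume "0 < \<epsilon>" and C: "{A \<in> Fpow X. \<delta> A \<le> \<epsilon>} \<subseteq> C"
    then obtain f where f: "f \<in> filter_sets X F" "\<forall>A\<in>Fpow f. \<delta> A \<le> \<epsilon>"
      using R by blast
    have "A \<in> Fpow X" if "A \<in> Fpow f" for A
      using that f(1) by (auto simp: filter_sets_def Fpow_def)
    then have "Fpow f \<subseteq> C"
      using f(2) C by auto
    then show "\<exists>f\<in>filter_sets X F. Fpow f \<subseteq> C"
      using f(1) by blast
  qed
qed

lemma conformity_converges_iff:
  assumes "x \<in> X"
  shows "conformity_converges X (generated_conformity X \<delta>) F x \<longleftrightarrow>
    (\<forall>\<epsilon>>0. \<exists>f\<in>filter_sets X F. \<forall>A\<in>Fpow f. \<delta> (insert x A) \<le> \<epsilon>)"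
proof
  assume L: "conformity_converges X (generated_conformity X \<delta>) F x"
  show "\<forall>\<epsilon>>0. \<exists>f\<in>filter_sets X F. \<forall>A\<in>Fpow f. \<delta> (insert x A) \<le> \<epsilon>"
  proof (intro allI impI)
    fix \<epsilon> :: real assume "0 < \<epsilon>"
    then have "{A \<in> Fpow X. \<delta> A \<le> \<epsilon>} \<in> filter_sets (Fpow X) (generated_conformity X \<delta>)"
      unfolding filter_sets_generated_conformity by blast
    then show "\<exists>f\<in>filter_sets X F. \<forall>A\<in>Fpow f. \<delta> (insert x A) \<le> \<epsilon>"
      using L unfolding conformity_converges_def by fastforce
  qed
next
  assume R: "\<forall>\<epsilon>>0. \<exists>f\<in>filter_sets X F. \<forall>A\<in>Fpow f. \<delta> (insert x A) \<le> \<epsilon>"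
  show "conformity_converges X (generated_conformity X \<delta>) F x"
    unfolding conformity_converges_def filter_sets_generated_conformity
  proof (intro ballI, clarify)
    fix C \<epsilon> assume "0 < \<epsilon>" and C: "{A \<in> Fpow X. \<delta> A \<le> \<epsilon>} \<subseteq> C"
    then obtain f where f: "f \<in> filter_sets X F" "\<forall>A\<in>Fpow f. \<delta> (insert x A) \<le> \<epsilon>"
      using R by blast
    have "insert x A \<in> Fpow X" if "A \<in> Fpow f" for A
      using that f(1) assms by (auto simp: filter_sets_def Fpow_def)
    then have "Fpow f \<subseteq> {A. A \<union> {x} \<in> C}"
      using f(2) C by auto
    then show "\<exists>f\<in>filter_sets X F. Fpow f \<subseteq> {A. A \<union> {x} \<in> C}"
      using f(1) by blast
  qed
qed

section \<open>The tail filter of a sequence\<close>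

lemma proper_filter_on_tail_filter:
  assumes "range s \<subseteq> X"
  shows "proper_filter_on X (filtermap s sequentially)"
  using assms
  by (auto simp: proper_filter_on_def filtermap_bot_iff le_principal eventually_filtermap
      intro!: always_eventually)

text \<open>Each member of the tail filter contains some \<open>s ` {N..}\<close>, and a condition on all finite
  subsets of a set is inherited by smaller sets.\<close>

lemma tail_filter_ex_member_iff:
  assumes "range s \<subseteq> X"
  shows "(\<exists>f\<in>filter_sets X (filtermap s sequentially). \<forall>A\<in>Fpow f. P A) \<longleftrightarrow>
    (\<exists>N. \<forall>A\<in>Fpow (s ` {N..}). P A)"
proof
  assume "\<exists>f\<in>filter_sets X (filtermap s sequentially). \<forall>A\<in>Fpow f. P A"
  then obtain f N where "\<forall>n\<ge>N. s n \<in> f" "\<forall>A\<in>Fpow f. P A"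
    by (auto simp: filter_sets_def eventually_filtermap eventually_sequentially)
  then show "\<exists>N. \<forall>A\<in>Fpow (s ` {N..}). P A"
    using Fpow_mono[of "s ` {N..}" f] by (intro exI[of _ N]) auto
next
  assume "\<exists>N. \<forall>A\<in>Fpow (s ` {N..}). P A"
  then obtain N where N: "\<forall>A\<in>Fpow (s ` {N..}). P A" ..
  have "s ` {N..} \<in> filter_sets X (filtermap s sequentially)"
    using assms by (auto simp: filter_sets_def eventually_filtermap eventually_sequentially)
  then show "\<exists>f\<in>filter_sets X (filtermap s sequentially). \<forall>A\<in>Fpow f. P A"
    using N by blast
qed

lemma seq_cauchy_iff_tail_filter:
  assumes "pseudodiversity X \<delta>" "range s \<subseteq> X"
  shows "seq_cauchy \<delta> s \<longleftrightarrow>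
    conformity_cauchy X (generated_conformity X \<delta>) (filtermap s sequentially)"
  unfolding seq_cauchy_iff[OF assms] conformity_cauchy_iff tail_filter_ex_member_iff[OF assms(2)] ..

lemma seq_converges_iff_tail_filter:
  assumes "pseudodiversity X \<delta>" "range s \<subseteq> X" "x \<in> X"
  shows "seq_converges \<delta> s x \<longleftrightarrow>
    conformity_converges X (generated_conformity X \<delta>) (filtermap s sequentially) x"
  unfolding seq_converges_iff[OF assms] conformity_converges_iff[OF assms(3)]
    tail_filter_ex_member_iff[OF assms(2)] ..

section \<open>Sequences extracted from Cauchy filters\<close>

text \<open>A sequence that runs through shrinking members of a Cauchy filter detects the limits of the
  filter, because countably many members witness the Cauchy property.\<close>

lemma cauchy_filter_obtains_sequence:
  assumes \<delta>: "pseudodiversity X \<delta>"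
    and F: "proper_filter_on X F"
    and cauchy: "conformity_cauchy X (generated_conformity X \<delta>) F"
  obtains s where "range s \<subseteq> X" "seq_cauchy \<delta> s"
    "\<And>x. x \<in> X \<Longrightarrow> seq_converges \<delta> s x \<Longrightarrow>
      conformity_converges X (generated_conformity X \<delta>) F x"
proof -
  have "\<exists>f\<in>filter_sets X F. \<forall>A\<in>Fpow f. \<delta> A \<le> 1 / real (Suc n)" for n
    using cauchy unfolding conformity_cauchy_iff by simp
  then obtain f where f: "\<And>n. f n \<in> filter_sets X F"
    and small: "\<And>n A. A \<in> Fpow (f n) \<Longrightarrow> \<delta> A \<le> 1 / real (Suc n)"
    by metis
  have "\<exists>y. \<forall>i\<le>n. y \<in> f i" for n
  proof -
    have "\<forall>\<^sub>F y in F. \<forall>i\<in>{..n}. y \<in> f i"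
      using f by (intro eventually_ball_finite) (auto simp: filter_sets_def)
    then show ?thesis
      using F eventually_happens' unfolding proper_filter_on_def by fastforce
  qed
  then obtain s where s: "\<And>n i. i \<le> n \<Longrightarrow> s n \<in> f i"
    by metis
  have f_sub: "f n \<subseteq> X" for n
    using f by (simp add: filter_sets_def)
  have s_sub: "range s \<subseteq> X"
    using s[OF order_refl] f_sub by blast
  have ex_small: "\<exists>N. \<forall>A\<in>Fpow (f N). \<delta> A \<le> \<epsilon>" if pos: "0 < \<epsilon>" for \<epsilon>
  proof -
    obtain N where "1 / real (Suc N) < \<epsilon>"
      by (rule nat_approx_posE[OF pos])
    then have "\<forall>A\<in>Fpow (f N). \<delta> A \<le> \<epsilon>"
      by (intro ballI) (rule order_trans[OF small less_imp_le])
    then show ?thesis ..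
  qed
  have "seq_cauchy \<delta> s"
    unfolding seq_cauchy_iff[OF \<delta> s_sub]
  proof (intro allI impI)
    fix \<epsilon> :: real assume "0 < \<epsilon>"
    then obtain N where "\<forall>A\<in>Fpow (f N). \<delta> A \<le> \<epsilon>"
      using ex_small by blast
    moreover have "Fpow (s ` {N..}) \<subseteq> Fpow (f N)"
      using s by (intro Fpow_mono) auto
    ultimately show "\<exists>N. \<forall>A\<in>Fpow (s ` {N..}). \<delta> A \<le> \<epsilon>"
      by blast
  qed
  moreover have "conformity_converges X (generated_conformity X \<delta>) F x"
    if x: "x \<in> X" and conv: "seq_converges \<delta> s x" for x
    unfolding conformity_converges_iff[OF x]
  proof (intro allI impI)
    fix \<epsilon> :: real assume \<epsilon>: "0 < \<epsilon>"
    obtain N where N: "\<forall>A\<in>Fpow (f N). \<delta> A \<le> \<epsilon> / 2"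
      using ex_small[of "\<epsilon> / 2"] \<epsilon> by auto
    obtain M where M: "\<forall>A\<in>Fpow (s ` {M..}). \<delta> (insert x A) \<le> \<epsilon> / 2"
      using conv half_gt_zero[OF \<epsilon>] unfolding seq_converges_iff[OF \<delta> s_sub x] by blast
    \<comment> \<open>The term \<open>c\<close> lies in \<open>f N\<close> and is close to \<open>x\<close>, so it links the two.\<close>
    define c where "c = s (max M N)"
    have c: "c \<in> f N" "{c} \<in> Fpow (s ` {M..})"
      unfolding c_def using s by (auto simp: Fpow_def)
    have "\<delta> (insert x A) \<le> \<epsilon>" if A: "A \<in> Fpow (f N)" for A
    proof -
      have "\<delta> (insert x A) \<le> \<delta> (insert c A) + \<delta> {c, x}"
        using A c(1) f_sub x by (intro pseudodiversity_triangle_point[OF \<delta>]) (auto simp: Fpow_def)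
      also have "\<delta> (insert c A) \<le> \<epsilon> / 2"
        using N A c(1) by (auto simp: Fpow_def)
      also have "\<delta> {c, x} \<le> \<epsilon> / 2"
        using bspec[OF M c(2)] by (simp add: insert_commute)
      finally show ?thesis by simp
    qed
    then show "\<exists>f\<in>filter_sets X F. \<forall>A\<in>Fpow f. \<delta> (insert x A) \<le> \<epsilon>"
      using f by blast
  qed
  ultimately show thesis
    using that s_sub by blast
qed

section \<open>Equivalence of the two notions of completeness\<close>

theorem theorem12:
  fixes X :: "'a set" and \<delta> :: "'a set \<Rightarrow> real"
  assumes "pseudodiversity X \<delta>"
  shows "diversity_complete X \<delta> \<longleftrightarrow> conformity_complete X (generated_conformity X \<delta>)"
proof
  assume L: "diversity_complete X \<delta>"
  show "conformity_complete X (generated_conformity X \<delta>)"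
    unfolding conformity_complete_def
  proof (intro allI impI)
    fix F assume "proper_filter_on X F" "conformity_cauchy X (generated_conformity X \<delta>) F"
    then obtain s where "range s \<subseteq> X" "seq_cauchy \<delta> s"
      and lim: "\<And>x. x \<in> X \<Longrightarrow> seq_converges \<delta> s x \<Longrightarrow>
        conformity_converges X (generated_conformity X \<delta>) F x"
      by (rule cauchy_filter_obtains_sequence[OF assms]) blast
    then obtain x where "x \<in> X" "seq_converges \<delta> s x"
      using L unfolding diversity_complete_def by blast
    then show "\<exists>x\<in>X. conformity_converges X (generated_conformity X \<delta>) F x"
      using lim by blast
  qed
next
  assume R: "conformity_complete X (generated_conformity X \<delta>)"
  show "diversity_complete X \<delta>"
    unfolding diversity_complete_def
  proof (intro allI impI)
    fix s assume s: "range s \<subseteq> X" "seq_cauchy \<delta> s"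
    then obtain x where "x \<in> X"
      "conformity_converges X (generated_conformity X \<delta>) (filtermap s sequentially) x"
      using R proper_filter_on_tail_filter[OF s(1)] seq_cauchy_iff_tail_filter[OF assms s(1)]
      unfolding conformity_complete_def by blast
    then show "\<exists>x\<in>X. seq_converges \<delta> s x"
      using seq_converges_iff_tail_filter[OF assms s(1)] by blast
  qed
qed

end
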